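(* Any streaming algorithm for \textsc{Diameter} in the AL model that works correctly on a family of graphs containing all "Diamond" graphs $D_N(x,y)$ (for all $N$ and all $x,y \in \{0,1\}^N$) and uses $p$ passes over the stream requires $\Omega(n/p)$ bits of memory, where $n$ is the number of vertices.
   Context: For $N\ge1$ and $x,y\in\{0,1\}^N$, the graph $D_N(x,y)$ on $10N+3$ vertices is built as follows. Take adjacent vertices $a,b$ and vertices $c_0,\dots,c_N$, each adjacent to both $a$ and $b$. For each $i\in\{1,\dots,N\}$ add a path $p_{i,1}p_{i,2}\cdots p_{i,9}$ on $9$ new vertices, with edges $c_{i-1}p_{i,1}$ and $p_{i,9}c_i$. Add the edges $ap_{i,2}$ and $ap_{i,6}$ exactly when $x_i = 0$, and the edges $bp_{i,4}$ and $bp_{i,8}$ exactly when $y_i = 0$. \textsc{Diameter}: compute $\max_{s,t} d(s,t)$. In the Adjacency List (AL) streaming model the graph arrives as a sequence of vertices in arbitrary fixed order, each with the full list of its incident edges. A $p$-pass algorithm reads the sequence $p$ times with unlimited computation; memory is in bits. "Requires $\Omega(f)$ bits" means there is a constant $c_0>0$ such that every such algorithm uses at least $c_0 f$ bits on some $n$-vertex input from the family, for all sufficiently large $n$ and all $p$.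
   Formalization: The bound is stated for vertex counts n = 10N+3 of Diamond graphs, not for all sufficiently large n: a family consisting only of Diamond graphs has no n-vertex input for any other n. *)

theory Defs
  imports Complex_Main "HOL-Library.FuncSet" "HOL-Library.Extended_Nat"
begin

type_synonym 'v graph = "'v set \<times> 'v set set"

abbreviation verts :: "'v graph \<Rightarrow> 'v set" where "verts G \<equiv> fst G"
abbreviation edges :: "'v graph \<Rightarrow> 'v set set" where "edges G \<equiv> snd G"

definition finite_graph :: "'v graph \<Rightarrow> bool" where
  "finite_graph G \<longleftrightarrow> finite (verts G) \<and> edges G \<subseteq> {{u, v} | u v. u \<in> verts G \<and> v \<in> verts G \<and> u \<noteq> v}"

definition adjacency :: "'v graph \<Rightarrow> ('v \<times> 'v) set" where
  "adjacency G = {(u, v). {u, v} \<in> edges G}"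

text \<open>The infimum of the empty set is \<open>\<infinity>\<close>, so vertices in different components have distance \<open>\<infinity>\<close>.\<close>

definition graph_dist :: "'v graph \<Rightarrow> 'v \<Rightarrow> 'v \<Rightarrow> enat" where
  "graph_dist G s t = (INF k \<in> {k. (s, t) \<in> adjacency G ^^ k}. enat k)"

definition graph_diameter :: "'v graph \<Rightarrow> enat" where
  "graph_diameter G = (SUP (s, t) \<in> verts G \<times> verts G. graph_dist G s t)"

text \<open>
  The vertex set depends on \<open>N\<close> only, never on \<open>x\<close> and \<open>y\<close>. Names outside the index
  ranges of \<open>diamond_verts\<close> do not occur in a Diamond graph.
\<close>

datatype vertex = A | B | C nat | P nat nat

definition bitstrings :: "nat \<Rightarrow> (nat \<Rightarrow> nat) set" where
  "bitstrings N = {1..N} \<rightarrow>\<^sub>E {0, 1}"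

definition diamond_verts :: "nat \<Rightarrow> vertex set" where
  "diamond_verts N = {A, B} \<union> {C i | i. i \<in> {0..N}} \<union> {P i j | i j. i \<in> {1..N} \<and> j \<in> {1..9}}"

definition diamond_edges :: "nat \<Rightarrow> (nat \<Rightarrow> nat) \<Rightarrow> (nat \<Rightarrow> nat) \<Rightarrow> vertex set set" where
  "diamond_edges N x y =
     {{A, B}}
   \<union> {{A, C i} | i. i \<in> {0..N}}
   \<union> {{B, C i} | i. i \<in> {0..N}}
   \<union> {{C (i - 1), P i 1} | i. i \<in> {1..N}}
   \<union> {{P i j, P i (j + 1)} | i j. i \<in> {1..N} \<and> j \<in> {1..8}}
   \<union> {{P i 9, C i} | i. i \<in> {1..N}}
   \<union> {{A, P i j} | i j. i \<in> {1..N} \<and> x i = 0 \<and> j \<in> {2, 6}}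
   \<union> {{B, P i j} | i j. i \<in> {1..N} \<and> y i = 0 \<and> j \<in> {4, 8}}"

definition diamond :: "nat \<Rightarrow> (nat \<Rightarrow> nat) \<Rightarrow> (nat \<Rightarrow> nat) \<Rightarrow> vertex graph" where
  "diamond N x y = (diamond_verts N, diamond_edges N x y)"

lemma finite_diamond_verts: "finite (diamond_verts N)"
  and card_diamond_verts: "card (diamond_verts N) = 10 * N + 3"
proof -
  let ?P = "(\<lambda>(i, j). P i j) ` ({1..N} \<times> {1..9})"
  have eq: "diamond_verts N = insert A (insert B (C ` {0..N} \<union> ?P))"
    by (auto simp: diamond_verts_def)
  show "finite (diamond_verts N)" unfolding eq by simp
  have "card (C ` {0..N}) = N + 1" by (subst card_image) (auto simp: inj_on_def)
  moreover have "card ?P = N * 9" by (subst card_image) (auto simp: inj_on_def)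
  moreover have "card (C ` {0..N} \<union> ?P) = card (C ` {0..N}) + card ?P"
    by (rule card_Un_disjoint) auto
  moreover have "card (diamond_verts N) = Suc (Suc (card (C ` {0..N} \<union> ?P)))"
    unfolding eq by (simp add: card_insert_if image_iff split_beta)
  ultimately show "card (diamond_verts N) = 10 * N + 3" by simp
qed

lemma finite_graph_diamond: "finite_graph (diamond N x y)"
proof -
  let ?Q = "{{u, v} | u v. u \<in> diamond_verts N \<and> v \<in> diamond_verts N \<and> u \<noteq> v}"
  have Q: "{u, v} \<in> ?Q" if "u \<in> diamond_verts N" "v \<in> diamond_verts N" "u \<noteq> v" for u v
    using that by blast
  have V: "A \<in> diamond_verts N" "B \<in> diamond_verts N"
    "C i \<in> diamond_verts N \<longleftrightarrow> i \<le> N"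
    "P i j \<in> diamond_verts N \<longleftrightarrow> 1 \<le> i \<and> i \<le> N \<and> 1 \<le> j \<and> j \<le> 9" for i j
    by (auto simp: diamond_verts_def)
  have "diamond_edges N x y \<subseteq> ?Q"
    unfolding diamond_edges_def by (intro Un_least subsetI; (elim CollectE exE conjE)?; (elim singletonE)?; hypsubst; intro Q)
      (auto simp: V)
  then show ?thesis
    by (simp add: finite_graph_def diamond_def finite_diamond_verts)
qed

type_synonym 'v item = "'v \<times> 'v set list"

definition al_stream :: "'v graph \<Rightarrow> 'v item list \<Rightarrow> bool" where
  "al_stream G S \<longleftrightarrow>
     distinct (map fst S) \<and> set (map fst S) = verts G \<and>
     (\<forall>(v, es) \<in> set S. distinct es \<and> set es = {e \<in> edges G. v \<in> e})"

text \<open>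
  A deterministic algorithm whose memory content is a bit string. Computation is unlimited,
  so transitions are arbitrary functions; memory is measured between consecutive items.
  The first argument of every component is the number of vertices, and the second argument of \<open>step\<close> and \<open>end_pass\<close> is the index of
  the current pass; both are known to the algorithm without occupying memory. An algorithm that
  does not have this information simply ignores these arguments. Memory carries over from one
  pass to the next through \<open>end_pass\<close>.
\<close>

record 'v algorithm =
  init :: "nat \<Rightarrow> bool list"
  step :: "nat \<Rightarrow> nat \<Rightarrow> 'v item \<Rightarrow> bool list \<Rightarrow> bool list"
  end_pass :: "nat \<Rightarrow> nat \<Rightarrow> bool list \<Rightarrow> bool list"
  answer :: "nat \<Rightarrow> bool list \<Rightarrow> enat"

primrec memory_after :: "'v algorithm \<Rightarrow> 'v item list \<Rightarrow> nat \<Rightarrow> bool list" where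
  "memory_after alg S 0 = init alg (length S)"
| "memory_after alg S (Suc i) =
     end_pass alg (length S) i (fold (step alg (length S) i) S (memory_after alg S i))"

text \<open>The memory in pass \<open>i\<close> (counted from 0) after reading the first \<open>k\<close> items of \<open>S\<close>.\<close>

definition memory_during :: "'v algorithm \<Rightarrow> 'v item list \<Rightarrow> nat \<Rightarrow> nat \<Rightarrow> bool list" where
  "memory_during alg S i k = fold (step alg (length S) i) (take k S) (memory_after alg S i)"

definition bits_used :: "'v algorithm \<Rightarrow> nat \<Rightarrow> 'v item list \<Rightarrow> nat" where
  "bits_used alg p S =
     Max ({length (memory_during alg S i k) | i k. i < p \<and> k \<le> length S}
          \<union> {length (memory_after alg S p)})"

definition computes_diameter :: "'v algorithm \<Rightarrow> nat \<Rightarrow> 'v graph set \<Rightarrow> bool" where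
  "computes_diameter alg p \<F> \<longleftrightarrow>
     (\<forall>G \<in> \<F>. \<forall>S. al_stream G S \<longrightarrow>
        answer alg (length S) (memory_after alg S p) = graph_diameter G)"

end

theory Submission
  imports Defs
begin

text \<open>
  A disjoint pair \<open>x\<close>, \<open>y\<close> gives diameter at most 7: in every block one of the two hubs
  is within distance 3 of the whole block. If \<open>x\<^sub>i = y\<^sub>i = 1\<close>, then \<open>P i 5\<close> is at distance
  at least 8 from the middle of every other block. List the vertices whose incident edges depend
  on \<open>x\<close> first. If the inputs \<open>(x, 1 - x)\<close> and \<open>(x', 1 - x')\<close> with \<open>x \<noteq> x'\<close> produce the same
  memory contents at the two cut points of every pass, then so do the crossed inputs
  \<open>(x, 1 - x')\<close> and \<open>(x', 1 - x)\<close>, one of which is not disjoint. So the \<open>2 ^ N\<close>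
  inputs \<open>(x, 1 - x)\<close> have distinct transcripts of \<open>2 * p\<close> memory contents each.
\<close>

section \<open>Distances\<close>

text \<open>A finite bound excludes the empty infimum, and a nonempty set of naturals attains its
  infimum. Upper bounds on distances thereby become statements about short walks.\<close>

lemma graph_dist_le_iff:
  "graph_dist G s t \<le> enat n \<longleftrightarrow> (\<exists>k \<le> n. (s, t) \<in> adjacency G ^^ k)"
proof
  assume le: "graph_dist G s t \<le> enat n"
  let ?K = "{k. (s, t) \<in> adjacency G ^^ k}"
  have ne: "enat ` ?K \<noteq> {}"
  proof
    assume "enat ` ?K = {}"
    then have "graph_dist G s t = top"
      unfolding graph_dist_def by (simp only: Inf_empty)
    with le show False
      by (simp add: top_enat_def)
  qed
  then have "Inf (enat ` ?K) \<in> enat ` ?K"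
    by (metis (no_types, lifting) Inf_enat_def LeastI ex_in_conv)
  then obtain k where "(s, t) \<in> adjacency G ^^ k" "graph_dist G s t = enat k"
    by (auto simp: graph_dist_def)
  with le show "\<exists>k \<le> n. (s, t) \<in> adjacency G ^^ k"
    by auto
next
  assume "\<exists>k \<le> n. (s, t) \<in> adjacency G ^^ k"
  then obtain k where "k \<le> n" "(s, t) \<in> adjacency G ^^ k"
    by blast
  then have "graph_dist G s t \<le> enat k"
    unfolding graph_dist_def by (intro INF_lower) simp
  with \<open>k \<le> n\<close> show "graph_dist G s t \<le> enat n"
    by (meson enat_ord_simps(1) order_trans)
qed

lemma graph_dist_refl [simp]: "graph_dist G s s \<le> enat n"
  unfolding graph_dist_le_iff by (intro exI[of _ 0]) simp

lemma graph_dist_edge: "{s, t} \<in> edges G \<Longrightarrow> graph_dist G s t \<le> enat 1"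
  unfolding graph_dist_le_iff by (intro exI[of _ 1]) (simp add: adjacency_def)

lemma graph_dist_triangle:
  assumes "graph_dist G s t \<le> enat m" "graph_dist G t u \<le> enat n"
  shows "graph_dist G s u \<le> enat (m + n)"
  using assms unfolding graph_dist_le_iff relpow_add
  by (metis add_mono relcompI relpow_add)

lemma graph_dist_sym: "graph_dist G s t = graph_dist G t s"
proof -
  have "(t, s) \<in> adjacency G ^^ k" if "(s, t) \<in> adjacency G ^^ k" for k s t
    using that
  proof (induction k arbitrary: t)
    case (Suc k)
    then obtain u where "(s, u) \<in> adjacency G ^^ k" "(u, t) \<in> adjacency G"
      by auto
    then show ?case
      using Suc.IH by (intro relpow_Suc_I2[of t u]) (auto simp: adjacency_def insert_commute)
  qed simp
  then have "{k. (s, t) \<in> adjacency G ^^ k} = {k. (t, s) \<in> adjacency G ^^ k}"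
    by blast
  then show ?thesis
    by (simp add: graph_dist_def)
qed

text \<open>A function that grows by at most 1 along each edge grows by at most \<open>k\<close>
  along a walk of length \<open>k\<close>. Exhibiting such a potential replaces an analysis of all
  walks.\<close>

lemma graph_dist_ge_potential:
  fixes f :: "'v \<Rightarrow> nat"
  assumes "\<And>u v. {u, v} \<in> edges G \<Longrightarrow> f v \<le> f u + 1"
  shows "enat (f t - f s) \<le> graph_dist G s t"
proof -
  have "f t \<le> f s + k" if "(s, t) \<in> adjacency G ^^ k" for k
    using that
  proof (induction k arbitrary: t)
    case (Suc k)
    then obtain u where "(s, u) \<in> adjacency G ^^ k" "(u, t) \<in> adjacency G"
      by auto
    then show ?case
      using Suc.IH[of u] assms[of u t] by (auto simp: adjacency_def)
  qed simp
  then show ?thesis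
    unfolding graph_dist_def by (intro INF_greatest) force
qed

section \<open>The diameter of a Diamond graph\<close>

lemma in_diamond_edges:
  "{A, B} \<in> diamond_edges N x y"
  "i \<le> N \<Longrightarrow> {C i, A} \<in> diamond_edges N x y"
  "i \<le> N \<Longrightarrow> {C i, B} \<in> diamond_edges N x y"
  "i \<in> {1..N} \<Longrightarrow> {P i 1, C (i - 1)} \<in> diamond_edges N x y"
  "i \<in> {1..N} \<Longrightarrow> {P i 9, C i} \<in> diamond_edges N x y"
  "i \<in> {1..N} \<Longrightarrow> j \<in> {1..8} \<Longrightarrow> {P i j, P i (j + 1)} \<in> diamond_edges N x y"
  "i \<in> {1..N} \<Longrightarrow> x i = 0 \<Longrightarrow> j \<in> {2, 6} \<Longrightarrow> {P i j, A} \<in> diamond_edges N x y"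
  "i \<in> {1..N} \<Longrightarrow> y i = 0 \<Longrightarrow> j \<in> {4, 8} \<Longrightarrow> {P i j, B} \<in> diamond_edges N x y"
  unfolding diamond_edges_def
  subgoal by simp
  subgoal by (subst insert_commute, rule UnI1, rule UnI1, rule UnI1, rule UnI1,
      rule UnI1, rule UnI1, rule UnI2, fastforce)
  subgoal by (subst insert_commute, rule UnI1, rule UnI1, rule UnI1, rule UnI1,
      rule UnI1, rule UnI2, fastforce)
  subgoal by (subst insert_commute, rule UnI1, rule UnI1, rule UnI1, rule UnI1,
      rule UnI2, fastforce)
  subgoal by (rule UnI1, rule UnI1, rule UnI2, fastforce)
  subgoal by (rule UnI1, rule UnI1, rule UnI1, rule UnI2, fastforce)
  subgoal by (subst insert_commute, rule UnI1, rule UnI2, fastforce)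
  subgoal by (subst insert_commute, rule UnI2, fastforce)
  done

text \<open>Number the block from \<open>C (i - 1)\<close> at position 0 to \<open>C i\<close> at
  position 10. The neighbours of \<open>A\<close> sit at 0, 2, 6, 10, those of \<open>B\<close> at
  0, 4, 8, 10. Gaps are at most 4, so each position is within 2 of a neighbour of the hub.\<close>

lemma
  assumes i: "i \<in> {1..N}" and j: "j \<in> {1..9}"
  shows dist_block_A: "x i = 0 \<Longrightarrow> graph_dist (diamond N x y) (P i j) A \<le> enat 3"
    and dist_block_B: "y i = 0 \<Longrightarrow> graph_dist (diamond N x y) (P i j) B \<le> enat 3"
proof -
  let ?d = "graph_dist (diamond N x y)"
  note edge = in_diamond_edges[where N = N and x = x and y = y]
  have E: "?d s t \<le> enat 1" if "{s, t} \<in> diamond_edges N x y" for s t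
    using that by (intro graph_dist_edge) (simp add: diamond_def)
  have tri: "?d s u \<le> enat 2" if "?d s t \<le> enat 1" "?d t u \<le> enat 1" for s t u
    using graph_dist_triangle[OF that] by (simp add: numeral_2_eq_2)
  have tri3: "?d s u \<le> enat 3" if "?d s t \<le> enat 1" "?d t u \<le> enat 2" for s t u
    using graph_dist_triangle[OF that] by (simp add: numeral_3_eq_3)
  have weaken: "?d s u \<le> enat 3" if "?d s u \<le> enat m" "m \<le> 3" for s u m
    using that by (meson enat_ord_simps(1) order_trans)
  have right: "?d (P i k) (P i (k + 1)) \<le> enat 1" if "k \<in> {1..8}" for k
    using that by (intro E edge(6)) (use i in auto)
  have left: "?d (P i (k + 1)) (P i k) \<le> enat 1" if "k \<in> {1..8}" for k
    using right[OF that] by (subst graph_dist_sym)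
  have c1: "?d (P i 1) (C (i - 1)) \<le> enat 1" and c9: "?d (P i 9) (C i) \<le> enat 1"
    using E[OF edge(4)[OF i]] E[OF edge(5)[OF i]] by simp_all
  have "i \<le> N" "i - 1 \<le> N"
    using i by auto
  then have CA: "?d (C (i - 1)) A \<le> enat 1" "?d (C i) A \<le> enat 1"
    and CB: "?d (C (i - 1)) B \<le> enat 1" "?d (C i) B \<le> enat 1"
    using E[OF edge(2)] E[OF edge(3)] by simp_all
  have jcases: "j = 1 \<or> j = 2 \<or> j = 3 \<or> j = 4 \<or> j = 5 \<or> j = 6 \<or> j = 7 \<or> j = 8 \<or> j = 9"
    using j by auto
  have l: "?d (P i 3) (P i 2) \<le> enat 1" "?d (P i 4) (P i 3) \<le> enat 1" "?d (P i 5) (P i 4) \<le> enat 1"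
    "?d (P i 6) (P i 5) \<le> enat 1" "?d (P i 7) (P i 6) \<le> enat 1" "?d (P i 8) (P i 7) \<le> enat 1"
    using left[of 2] left[of 3] left[of 4] left[of 5] left[of 6] left[of 7] by simp_all
  have r: "?d (P i 2) (P i 3) \<le> enat 1" "?d (P i 3) (P i 4) \<le> enat 1"
    "?d (P i 5) (P i 6) \<le> enat 1" "?d (P i 7) (P i 8) \<le> enat 1"
    using right[of 2] right[of 3] right[of 5] right[of 7] by simp_all
  show "?d (P i j) A \<le> enat 3" if "x i = 0"
  proof -
    have a: "?d (P i 2) A \<le> enat 1" "?d (P i 6) A \<le> enat 1"
      using E[OF edge(7)[of i]] that i by simp_all
    have "?d (P i 1) A \<le> enat 2" "?d (P i 3) A \<le> enat 2" "?d (P i 5) A \<le> enat 2"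
      "?d (P i 7) A \<le> enat 2" "?d (P i 9) A \<le> enat 2"
      using tri[OF c1 CA(1)] tri[OF l(1) a(1)] tri[OF r(3) a(2)] tri[OF l(5) a(2)]
        tri[OF c9 CA(2)] by auto
    moreover from this have "?d (P i 4) A \<le> enat 3" "?d (P i 8) A \<le> enat 3"
      using tri3[OF l(2)] tri3[OF l(6)] by auto
    ultimately show ?thesis
      using jcases a weaken by auto
  qed
  show "?d (P i j) B \<le> enat 3" if "y i = 0"
  proof -
    have b: "?d (P i 4) B \<le> enat 1" "?d (P i 8) B \<le> enat 1"
      using E[OF edge(8)[of i]] that i by simp_all
    have "?d (P i 1) B \<le> enat 2" "?d (P i 3) B \<le> enat 2" "?d (P i 5) B \<le> enat 2"
      "?d (P i 7) B \<le> enat 2" "?d (P i 9) B \<le> enat 2"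
      using tri[OF c1 CB(1)] tri[OF r(2) b(1)] tri[OF l(3) b(1)] tri[OF r(4) b(2)]
        tri[OF c9 CB(2)] by auto
    moreover from this have "?d (P i 2) B \<le> enat 3" "?d (P i 6) B \<le> enat 3"
      using tri3[OF r(1)] tri3[OF l(4)] by auto
    ultimately show ?thesis
      using jcases b weaken by auto
  qed
qed

text \<open>Each vertex is within 3 of one hub and, through the edge between the hubs, within 4 of
  the other. Two vertices with the same near hub are joined in 3 + 3 steps, otherwise in 3 +
  4.\<close>

lemma diameter_diamond_disjoint:
  assumes "\<And>i. i \<in> {1..N} \<Longrightarrow> x i = 0 \<or> y i = 0"
  shows "graph_diameter (diamond N x y) \<le> enat 7"
proof -
  let ?d = "graph_dist (diamond N x y)"
  have AB: "?d A B \<le> enat 1" "?d B A \<le> enat 1"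
    using graph_dist_edge[of A B "diamond N x y"]
    by (simp_all add: diamond_def in_diamond_edges graph_dist_sym[of _ B])
  have weaken: "?d s u \<le> enat n" if "?d s u \<le> enat m" "m \<le> n" for s u m n
    using that by (meson enat_ord_simps(1) order_trans)
  have near: "?d v A \<le> enat 3 \<and> ?d v B \<le> enat 4 \<or> ?d v A \<le> enat 4 \<and> ?d v B \<le> enat 3"
    if v: "v \<in> diamond_verts N" for v
  proof -
    have "?d v A \<le> enat 3 \<or> ?d v B \<le> enat 3"
    proof (cases v)
      case B
      then show ?thesis by simp
    next
      case (C i)
      then have "?d v A \<le> enat 1"
        using v by (intro graph_dist_edge)
          (auto simp: diamond_def diamond_verts_def in_diamond_edges)
      from weaken[OF this, of 3] show ?thesis by simp
    next
      case (P i j)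
      then have ij: "i \<in> {1..N}" "j \<in> {1..9}"
        using v by (auto simp: diamond_verts_def)
      then show ?thesis
        using assms[OF ij(1)] dist_block_A[OF ij] dist_block_B[OF ij] P by auto
    qed simp
    then show ?thesis
      using graph_dist_triangle[OF _ AB(1), of v 3] graph_dist_triangle[OF _ AB(2), of v 3] by auto
  qed
  have "?d s t \<le> enat 7" if s: "s \<in> diamond_verts N" and t: "t \<in> diamond_verts N" for s t
  proof -
    have "?d s t \<le> enat (m + n)" if "?d s h \<le> enat m" "?d t h \<le> enat n" for h m n
      using graph_dist_triangle[OF that(1)] that(2) by (simp add: graph_dist_sym[of _ t])
    from this[of A 3 3] this[of A 3 4] this[of A 4 3] this[of B 3 3] weaken[of s t 6 7]
    show ?thesis
      using near[OF s] near[OF t] by auto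
  qed
  then show ?thesis
    unfolding graph_diameter_def by (auto intro!: SUP_least simp: diamond_def)
qed

text \<open>Block \<open>i\<close> is a bare path, so from \<open>P i 5\<close> either end costs 5
  steps and a hub at least 6. Hubs reach another block only at positions 2, 4, 6, 8, hence at cost
  at least 7, and its middle is one step further.\<close>

lemma diameter_diamond_intersecting:
  assumes "N \<ge> 2" and i: "i \<in> {1..N}" and "x i \<noteq> 0" "y i \<noteq> 0"
  shows "enat 8 \<le> graph_diameter (diamond N x y)"
proof -
  obtain k where k: "k \<in> {1..N}" "k \<noteq> i"
  proof
    show "(if i = 1 then 2 else 1) \<in> {1..N}" "(if i = 1 then 2 else 1) \<noteq> i"
      using assms(1) by auto
  qed
  \<comment> \<open>a lower bound for the distance from \<open>P i 5\<close> that ignores the bits of the other blocks\<close>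
  define f where "f v = (case v of A \<Rightarrow> 6 | B \<Rightarrow> 6 | C _ \<Rightarrow> 5
    | P m j \<Rightarrow> if m = i then (if j \<le> 5 then 5 - j else j - 5)
       else if j \<in> {1, 9} then 6 else if j = 5 then 8 else 7)" for v :: vertex
  have lip: "f v \<le> f u + 1 \<and> f u \<le> f v + 1" if "{u, v} \<in> diamond_edges N x y" for u v
    using that assms(3,4) unfolding diamond_edges_def
    by (auto simp: f_def doubleton_eq_iff split: if_splits)
  have "enat (f (P k 5) - f (P i 5)) \<le> graph_dist (diamond N x y) (P i 5) (P k 5)"
    by (rule graph_dist_ge_potential) (use lip in \<open>auto simp: diamond_def\<close>)
  also have "\<dots> \<le> graph_diameter (diamond N x y)"
    unfolding graph_diameter_def using i k
    by (intro SUP_upper2[of "(P i 5, P k 5)"]) (auto simp: diamond_def diamond_verts_def)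
  finally show ?thesis
    using k by (simp add: f_def)
qed

section \<open>A stream that splits into a part for each input\<close>

text \<open>One fixed enumeration per set: equal sets of incident edges then give literally equal
  stream items, as the crossing of two streams requires.\<close>

definition list_of :: "'a set \<Rightarrow> 'a list" where
  "list_of F = (SOME xs. distinct xs \<and> set xs = F)"

lemma list_of: "finite F \<Longrightarrow> distinct (list_of F) \<and> set (list_of F) = F"
  unfolding list_of_def by (rule someI_ex) (metis finite_distinct_list)

definition al_items :: "'v graph \<Rightarrow> 'v set \<Rightarrow> 'v item list" where
  "al_items G V = map (\<lambda>v. (v, list_of {e \<in> edges G. v \<in> e})) (list_of V)"

lemma length_al_items [simp]: "length (al_items G V) = length (list_of V)"
  by (simp add: al_items_def)

lemma al_items_cong:
  assumes "finite V"
    and "\<And>v. v \<in> V \<Longrightarrow> {e \<in> edges G. v \<in> e} = {e \<in> edges H. v \<in> e}"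
  shows "al_items G V = al_items H V"
  unfolding al_items_def by (rule map_cong) (simp_all add: assms list_of)

lemma al_stream_al_items:
  assumes G: "finite_graph G" and "verts G = V \<union> W" "V \<inter> W = {}"
  shows "al_stream G (al_items G V @ al_items G W)"
proof -
  have fin: "finite (verts G)" "edges G \<subseteq> Pow (verts G)"
    using G by (auto simp: finite_graph_def)
  then have "finite V" "finite W" "finite (edges G)"
    using assms(2) finite_subset[of "edges G" "Pow (verts G)"] by auto
  then show ?thesis
    using assms(2,3) list_of[of V] list_of[of W] list_of[of "{e \<in> edges G. v \<in> e}" for v]
    by (auto simp: al_stream_def al_items_def comp_def)
qed

text \<open>Both endpoints of every edge depending on \<open>x\<close> lie here, and both endpoints
  of every edge depending on \<open>y\<close> lie in \<open>y_verts\<close>. Only edges common to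
  all inputs cross the cut.\<close>

definition x_verts :: "nat \<Rightarrow> vertex set" where
  "x_verts N = {A} \<union> {P i j | i j. i \<in> {1..N} \<and> j \<in> {2, 6}}"

abbreviation y_verts :: "nat \<Rightarrow> vertex set" where
  "y_verts N \<equiv> diamond_verts N - x_verts N"

lemma x_verts_subset: "x_verts N \<subseteq> diamond_verts N"
  by (auto simp: x_verts_def diamond_verts_def)

definition hub_edges :: "nat \<Rightarrow> vertex \<Rightarrow> nat set \<Rightarrow> (nat \<Rightarrow> nat) \<Rightarrow> vertex set set" where
  "hub_edges N h J x = {{h, P i j} | i j. i \<in> {1..N} \<and> x i = 0 \<and> j \<in> J}"

definition common_edges :: "nat \<Rightarrow> vertex set set" where
  "common_edges N =
     {{A, B}}
   \<union> {{A, C i} | i. i \<in> {0..N}}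
   \<union> {{B, C i} | i. i \<in> {0..N}}
   \<union> {{C (i - 1), P i 1} | i. i \<in> {1..N}}
   \<union> {{P i j, P i (j + 1)} | i j. i \<in> {1..N} \<and> j \<in> {1..8}}
   \<union> {{P i 9, C i} | i. i \<in> {1..N}}"

lemma diamond_edges_split:
  "diamond_edges N x y = common_edges N \<union> hub_edges N A {2, 6} x \<union> hub_edges N B {4, 8} y"
  unfolding diamond_edges_def common_edges_def hub_edges_def by (rule refl)

lemma x_verts_incident:
  assumes "v \<in> x_verts N"
  shows "{e \<in> diamond_edges N x y. v \<in> e} = {e \<in> diamond_edges N x y'. v \<in> e}"
proof -
  have "v \<notin> e" if "e \<in> hub_edges N B {4, 8} y" for e y
    using that assms by (auto simp: hub_edges_def x_verts_def)
  then show ?thesis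
    unfolding diamond_edges_split[of N x] by blast
qed

lemma y_verts_incident:
  assumes "v \<in> y_verts N"
  shows "{e \<in> diamond_edges N x y. v \<in> e} = {e \<in> diamond_edges N x' y. v \<in> e}"
proof -
  have "v \<notin> e" if "e \<in> hub_edges N A {2, 6} x" for e x
    using that assms by (auto simp: hub_edges_def x_verts_def)
  then show ?thesis
    unfolding diamond_edges_split[of N _ y] by blast
qed

text \<open>The zero input is a placeholder: by \<open>x_verts_incident\<close> any other second
  input gives the same list. The same holds for the first input in \<open>y_part\<close>.\<close>

definition x_part :: "nat \<Rightarrow> (nat \<Rightarrow> nat) \<Rightarrow> vertex item list" where
  "x_part N x = al_items (diamond N x (\<lambda>_. 0)) (x_verts N)"

definition y_part :: "nat \<Rightarrow> (nat \<Rightarrow> nat) \<Rightarrow> vertex item list" where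
  "y_part N y = al_items (diamond N (\<lambda>_. 0) y) (y_verts N)"

lemma al_stream_parts: "al_stream (diamond N x y) (x_part N x @ y_part N y)"
proof -
  have "finite (x_verts N)"
    using x_verts_subset finite_diamond_verts by (rule finite_subset)
  then have "x_part N x = al_items (diamond N x y) (x_verts N)"
    unfolding x_part_def
    by (rule al_items_cong) (simp only: diamond_def snd_conv, rule x_verts_incident)
  moreover have "y_part N y = al_items (diamond N x y) (y_verts N)"
    unfolding y_part_def
    by (rule al_items_cong)
      (simp add: finite_diamond_verts, simp only: diamond_def snd_conv, rule y_verts_incident)
  moreover have "al_stream (diamond N x y)
      (al_items (diamond N x y) (x_verts N) @ al_items (diamond N x y) (y_verts N))"
    by (rule al_stream_al_items[OF finite_graph_diamond])
      (use x_verts_subset[of N] in \<open>auto simp: diamond_def\<close>)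
  ultimately show ?thesis
    by simp
qed

section \<open>Transcripts\<close>

text \<open>This is the communication between the holders of \<open>S\<close> and \<open>T\<close>:
  two messages per pass. Restricting the function to \<open>{..<p}\<close> places transcripts in a
  finite extensional function space that can be counted.\<close>

definition transcript ::
  "'v algorithm \<Rightarrow> nat \<Rightarrow> 'v item list \<Rightarrow> 'v item list \<Rightarrow> nat \<Rightarrow> bool list \<times> bool list"
  where "transcript alg p S T = (\<lambda>i \<in> {..<p}.
    (memory_during alg (S @ T) i (length S), memory_after alg (S @ T) (Suc i)))"

text \<open>The cut-and-paste property of protocols, by induction on passes. Reading
  \<open>S\<close> leads to the common memory at the cut; from there \<open>T'\<close> acts as in
  the run on \<open>S' @ T'\<close>, whose memory after the pass is again common. Equal lengths
  matter because the algorithm knows the length of the stream.\<close>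

lemma memory_after_crossed:
  assumes tr: "transcript alg p S T = transcript alg p S' T'"
    and len: "length S = length S'" "length T = length T'"
    and "i \<le> p"
  shows "memory_after alg (S @ T') i = memory_after alg (S @ T) i"
  using \<open>i \<le> p\<close>
proof (induction i)
  case 0
  then show ?case by (simp add: len)
next
  case (Suc i)
  have eq: "memory_during alg (S @ T) i (length S) = memory_during alg (S' @ T') i (length S')"
    "memory_after alg (S @ T) (Suc i) = memory_after alg (S' @ T') (Suc i)"
    using fun_cong[OF tr, of i] Suc.prems by (auto simp: transcript_def simp del: memory_after.simps)
  have mem: "memory_after alg (U @ V) (Suc i) =
    end_pass alg (length (U @ V)) i
      (fold (step alg (length (U @ V)) i) V (memory_during alg (U @ V) i (length U)))" for U V
    by (simp add: memory_during_def)
  have "memory_during alg (S @ T') i (length S) = memory_during alg (S @ T) i (length S)"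
    using Suc by (simp add: memory_during_def len)
  then have "memory_after alg (S @ T') (Suc i) = memory_after alg (S' @ T') (Suc i)"
    unfolding mem eq(1) using len by simp
  then show ?case
    using eq(2) by simp
qed

section \<open>Counting transcripts over a fooling set\<close>

lemma length_memory_le_bits_used:
  shows "i < p \<Longrightarrow> k \<le> length S \<Longrightarrow> length (memory_during alg S i k) \<le> bits_used alg p S"
    and "i < p \<Longrightarrow> length (memory_after alg S (Suc i)) \<le> bits_used alg p S"
proof -
  let ?M = "{length (memory_during alg S i k) | i k. i < p \<and> k \<le> length S}
    \<union> {length (memory_after alg S p)}"
  have "{length (memory_during alg S i k) | i k. i < p \<and> k \<le> length S} =
    (\<lambda>(i, k). length (memory_during alg S i k)) ` ({..<p} \<times> {..length S})"
    by auto
  then have "finite ?M"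
    by simp
  then have le: "l \<le> bits_used alg p S" if "l \<in> ?M" for l
    using that unfolding bits_used_def by (rule Max_ge)
  then show during: "length (memory_during alg S i k) \<le> bits_used alg p S"
    if "i < p" "k \<le> length S" for i k
    using that by blast
  have start: "memory_after alg S i = memory_during alg S i 0" for i
    by (simp add: memory_during_def)
  show "length (memory_after alg S (Suc i)) \<le> bits_used alg p S" if "i < p"
  \<comment> \<open>Memory after an earlier pass is counted as the start \<open>k = 0\<close> of the
    next one; after the last pass it is the separate element of the maximum.\<close>
  proof (cases "Suc i = p")
    case True
    then show ?thesis by (intro le) simp
  next
    case False
    then show ?thesis
      using that unfolding start by (intro during) auto
  qed
qed

text \<open>Unlike \<open>2 ^ (m + 1)\<close>, the bound \<open>2 ^ (2 * m)\<close> is exact for \<open>m = 0\<close>, which makes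
  the final estimate valid also when \<open>p\<close> exceeds \<open>N\<close>.\<close>

lemma bool_lists_length_le:
  shows "finite {bs :: bool list. length bs \<le> m}"
    and "card {bs :: bool list. length bs \<le> m} \<le> 2 ^ (2 * m)"
proof -
  show "finite {bs :: bool list. length bs \<le> m}"
    using finite_lists_length_le[of "UNIV :: bool set" m] by simp
  have "card {bs :: bool list. length bs \<le> m} = (\<Sum>i\<le>m. 2 ^ i)"
    using card_lists_length_le[of "UNIV :: bool set" m] by simp
  also have "\<dots> \<le> 2 ^ (2 * m)"
  proof (induction m)
    case (Suc m)
    have "(2::nat) ^ m \<le> 2 ^ (2 * m)"
      by (rule power_increasing) auto
    with Suc show ?case
      by (simp del: power_increasing_iff)
  qed simp
  finally show "card {bs :: bool list. length bs \<le> m} \<le> 2 ^ (2 * m)" .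
qed

text \<open>The pairs \<open>(x, complement x N)\<close> are the standard fooling set for set
  disjointness.\<close>

definition complement :: "(nat \<Rightarrow> nat) \<Rightarrow> nat \<Rightarrow> (nat \<Rightarrow> nat)" where
  "complement x N = (\<lambda>i \<in> {1..N}. 1 - x i)"

lemma complement_bitstrings: "complement x N \<in> bitstrings N"
  by (auto simp: complement_def bitstrings_def)

text \<open>With memory at most \<open>m\<close> bits, \<open>2 * p\<close> contents of at most
  \<open>2 ^ (2 * m)\<close> values each give at most \<open>2 ^ (4 * p * m)\<close> transcripts. If
  this is below \<open>2 ^ N\<close>, two inputs of the fooling set collide.\<close>

lemma bitstrings_memory_lower_bound:
  assumes N: "N \<ge> 2"
    and cd: "computes_diameter alg p \<F>"
    and \<F>: "\<And>x y. x \<in> bitstrings N \<Longrightarrow> y \<in> bitstrings N \<Longrightarrow> diamond N x y \<in> \<F>"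
  shows "\<exists>x \<in> bitstrings N.
    N \<le> 4 * p * bits_used alg p (x_part N x @ y_part N (complement x N))"
proof (rule ccontr)
  let ?S = "x_part N" and ?T = "\<lambda>x. y_part N (complement x N)"
  \<comment> \<open>For \<open>p > 0\<close> this is the largest \<open>m\<close> with
    \<open>4 * p * m < N\<close>. For \<open>p = 0\<close> division by zero gives 0, and the single
    empty transcript still forces a collision.\<close>
  define m where "m = (N - 1) div (4 * p)"
  define L where "L = {bs :: bool list. length bs \<le> m}"
  assume "\<not> ?thesis"
  then have small: "4 * p * bits_used alg p (?S x @ ?T x) < N" if "x \<in> bitstrings N" for x
    using that by force
  have m: "bits_used alg p (?S x @ ?T x) \<le> m" if "x \<in> bitstrings N" and "p > 0" for x
  proof -
    have "bits_used alg p (?S x @ ?T x) * (4 * p) \<le> N - 1"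
      using small[OF that(1)] by (simp add: mult.commute)
    then show ?thesis
      using that(2) unfolding m_def by (simp add: less_eq_div_iff_mult_less_eq)
  qed
  have range: "transcript alg p (?S x) (?T x) \<in> {..<p} \<rightarrow>\<^sub>E L \<times> L" if "x \<in> bitstrings N" for x
  proof -
    have "memory_during alg (?S x @ ?T x) i (length (?S x)) \<in> L"
      "memory_after alg (?S x @ ?T x) (Suc i) \<in> L" if "i < p" for i
      using that m[OF \<open>x \<in> bitstrings N\<close>]
        length_memory_le_bits_used(1)[OF that, of "length (?S x)" "?S x @ ?T x" alg]
        length_memory_le_bits_used(2)[OF that, of alg "?S x @ ?T x"]
      unfolding L_def by (auto intro: order_trans simp del: memory_after.simps)
    then show ?thesis
      by (auto simp: transcript_def simp del: memory_after.simps)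
  qed
  have fin: "finite L"
    unfolding L_def by (rule bool_lists_length_le)
  have "card ({..<p} \<rightarrow>\<^sub>E L \<times> L) = (card L * card L) ^ p"
    using fin by (simp add: card_PiE card_cartesian_product)
  also have "\<dots> \<le> (2 ^ (2 * m) * 2 ^ (2 * m)) ^ p"
    unfolding L_def by (intro power_mono mult_mono bool_lists_length_le) auto
  also have "\<dots> = 2 ^ (4 * p * m)"
    by (simp flip: power_add power_mult)
  also have "\<dots> < 2 ^ N"
  proof -
    have "m * (4 * p) \<le> N - 1"
      unfolding m_def by (rule div_times_less_eq_dividend)
    then show ?thesis
      using N by (intro power_strict_increasing) (auto simp: algebra_simps)
  qed
  also have "\<dots> = card (bitstrings N)"
    by (simp add: bitstrings_def card_PiE numeral_2_eq_2)
  finally have "card ({..<p} \<rightarrow>\<^sub>E L \<times> L) < card (bitstrings N)" .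
  moreover have "card ((\<lambda>x. transcript alg p (?S x) (?T x)) ` bitstrings N)
      \<le> card ({..<p} \<rightarrow>\<^sub>E L \<times> L)"
    using range fin by (intro card_mono) (auto intro!: finite_PiE)
  ultimately have "\<not> inj_on (\<lambda>x. transcript alg p (?S x) (?T x)) (bitstrings N)"
    by (intro pigeonhole) linarith
  then obtain x x' where x: "x \<in> bitstrings N" and x': "x' \<in> bitstrings N" and "x \<noteq> x'"
    and tr: "transcript alg p (?S x) (?T x) = transcript alg p (?S x') (?T x')"
    unfolding inj_on_def by blast
  have len: "length (x_part N u) = length (x_part N v)"
    "length (y_part N u) = length (y_part N v)" for u v
    by (simp_all add: x_part_def y_part_def)
  \<comment> \<open>The answer depends only on the stream length and the final memory, so the
    crossed input inherits the answer of the disjoint input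
    \<open>(u, complement u N)\<close>.\<close>
  have crossed: "graph_diameter (diamond N u (complement v N)) \<le> enat 7"
    if u: "u \<in> bitstrings N" and "v \<in> bitstrings N"
      and "transcript alg p (?S u) (?T u) = transcript alg p (?S v) (?T v)" for u v
  proof -
    have ans: "answer alg (length (?S a @ ?T b)) (memory_after alg (?S a @ ?T b) p) =
        graph_diameter (diamond N a (complement b N))" if "a \<in> bitstrings N" for a b
      using cd \<F>[OF that complement_bitstrings] al_stream_parts
      unfolding computes_diameter_def by blast
    have "graph_diameter (diamond N u (complement v N)) =
        graph_diameter (diamond N u (complement u N))"
      using ans[OF u, of u] ans[OF u, of v] memory_after_crossed[OF that(3) len order_refl]
        len(2)[of "complement u N" "complement v N"]
      by simp
    also have "\<dots> \<le> enat 7"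
      using u by (intro diameter_diamond_disjoint)
        (auto simp: complement_def bitstrings_def PiE_def Pi_def)
    finally show ?thesis .
  qed
  have far: "enat 8 \<le> graph_diameter (diamond N u (complement v N))"
    if "i \<in> {1..N}" "u i = 1" "v i = 0" for u v i
    using N that by (intro diameter_diamond_intersecting[OF _ that(1)]) (auto simp: complement_def)
  obtain i where i: "i \<in> {1..N}" "x i \<noteq> x' i"
    using \<open>x \<noteq> x'\<close> x x' unfolding bitstrings_def by (metis PiE_ext)
  \<comment> \<open>Which of the two crossed inputs intersects at \<open>i\<close> depends on which
    string has the 1 there, so \<open>crossed\<close> is applied in both orders.\<close>
  then have "x i = 1 \<and> x' i = 0 \<or> x' i = 1 \<and> x i = 0"
    using x x' by (fastforce simp: bitstrings_def PiE_def Pi_def)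
  moreover have False if "enat 8 \<le> g" "g \<le> enat 7" for g
    using order_trans[OF that] by simp
  ultimately show False
    using far[OF i(1)] crossed[OF x x' tr] crossed[OF x' x tr[symmetric]] by blast
qed

theorem theorem23:
  "\<exists>c\<^sub>0 > (0::real). \<exists>n\<^sub>0 :: nat.
     \<forall>(\<F> :: vertex graph set) (alg :: vertex algorithm) (p :: nat) (N :: nat) (n :: nat).
       (\<forall>G \<in> \<F>. finite_graph G) \<and>
       (\<forall>M \<ge> 1. \<forall>x \<in> bitstrings M. \<forall>y \<in> bitstrings M. diamond M x y \<in> \<F>) \<and>
       p \<ge> 1 \<and> computes_diameter alg p \<F> \<and>
       N \<ge> 1 \<and> n = 10 * N + 3 \<and> n \<ge> n\<^sub>0 \<longrightarrow>
       (\<exists>G \<in> \<F>. \<exists>S. card (verts G) = n \<and> al_stream G S \<and>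
          c\<^sub>0 * (real n / real p) \<le> real (bits_used alg p S))"
proof -
  \<comment> \<open>The constant is 52 = 4 * 13, with 13 from
    \<open>10 * N + 3 \<le> 13 * N\<close>; the threshold 23 is the vertex count for
    \<open>N = 2\<close>.\<close>
  have "\<exists>G \<in> \<F>. \<exists>S. card (verts G) = n \<and> al_stream G S \<and>
      1 / 52 * (real n / real p) \<le> real (bits_used alg p S)"
    if \<F>: "\<forall>M \<ge> 1. \<forall>x \<in> bitstrings M. \<forall>y \<in> bitstrings M. diamond M x y \<in> \<F>"
      and p: "p \<ge> 1" and cd: "computes_diameter alg p \<F>"
      and N: "N \<ge> 1" and n: "n = 10 * N + 3" "n \<ge> 23"
    for \<F> :: "vertex graph set" and alg :: "vertex algorithm" and p N n :: nat
  proof -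
    have "N \<ge> 2"
      using n by simp
    moreover have dia: "diamond N x y \<in> \<F>" if "x \<in> bitstrings N" "y \<in> bitstrings N" for x y
      using \<F> N that by blast
    ultimately obtain x where x: "x \<in> bitstrings N"
      and bits: "N \<le> 4 * p * bits_used alg p (x_part N x @ y_part N (complement x N))"
      using bitstrings_memory_lower_bound[OF _ cd] by blast
    let ?S = "x_part N x @ y_part N (complement x N)"
    have "n \<le> 13 * N"
      using n N by simp
    also have "\<dots> \<le> 52 * p * bits_used alg p ?S"
      using bits by simp
    finally have "real n \<le> real (52 * p * bits_used alg p ?S)"
      by (rule of_nat_mono)
    then have "1 / 52 * (real n / real p) \<le> real (bits_used alg p ?S)"
      using p by (simp add: field_simps)
    moreover have "card (verts (diamond N x (complement x N))) = n"
      by (simp add: diamond_def card_diamond_verts n)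
    ultimately show ?thesis
      using dia[OF x complement_bitstrings] al_stream_parts by blast
  qed
  then show ?thesis
    by (intro exI[of _ "1 / 52"] exI[of _ 23] conjI) (simp, blast)
qed

end
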